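(* Let $\mathfrak{g}$ be a non-Abelian and indecomposable quadratic Lie algebra with invariant metric $B$ over an algebraically closed field $\mathbb{F}$ of characteristic zero. Let $\mathcal{S}$ be a commutative and associative algebra with unit over $\mathbb{F}$. Then the current Lie algebra $\mathfrak{g}\otimes\mathcal{S}$ admits an invariant metric if and only if $\mathcal{S}$ admits a non-degenerate, symmetric and invariant bilinear form.
   Context: All algebras and vector spaces are finite-dimensional. An invariant metric on a Lie algebra $\mathfrak{g}$ is a non-degenerate, symmetric bilinear form $B:\mathfrak{g}\times\mathfrak{g}\to\mathbb{F}$ with $B(x,[y,z])=B([x,y],z)$ for all $x,y,z$; a quadratic Lie algebra is a Lie algebra equipped with an invariant metric. A quadratic Lie algebra $(\mathfrak{g},B)$ is indecomposable if it is not the $B$-orthogonal direct sum of two non-zero ideals (equivalently, it has no non-zero proper ideal on which $B$ is non-degenerate). The current Lie algebra of $\mathfrak{g}$ by $\mathcal{S}$ is the vector space $\mathfrak{g}\otimes\mathcal{S}$ (tensor product over $\mathbb{F}$) with bracket $[x\otimes s,y\otimes t]=[x,y]\otimes st$. A bilinear form $\gamma:\mathcal{S}\times\mathcal{S}\to\mathbb{F}$ is invariant if $\gamma(s,s't)=\gamma(ss',t)$ for all $s,s',t\in\mathcal{S}$. *)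

theory Defs
  imports "HOL-Computational_Algebra.Polynomial" "HOL-Library.Function_Algebras"
begin

section \<open>Bilinear maps and forms\<close>

definition bilinear_on ::
  "('f::field \<Rightarrow> 'a::ab_group_add \<Rightarrow> 'a) \<Rightarrow> 'a set \<Rightarrow> ('f \<Rightarrow> 'b::ab_group_add \<Rightarrow> 'b) \<Rightarrow> 'b set
    \<Rightarrow> ('f \<Rightarrow> 'c::ab_group_add \<Rightarrow> 'c) \<Rightarrow> ('a \<Rightarrow> 'b \<Rightarrow> 'c) \<Rightarrow> bool" where
  "bilinear_on s1 V s2 W s3 f \<longleftrightarrow>
     (\<forall>x\<in>V. \<forall>x'\<in>V. \<forall>y\<in>W. f (x + x') y = f x y + f x' y) \<and>
     (\<forall>c. \<forall>x\<in>V. \<forall>y\<in>W. f (s1 c x) y = s3 c (f x y)) \<and>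
     (\<forall>x\<in>V. \<forall>y\<in>W. \<forall>y'\<in>W. f x (y + y') = f x y + f x y') \<and>
     (\<forall>c. \<forall>x\<in>V. \<forall>y\<in>W. f x (s2 c y) = s3 c (f x y))"

definition symmetric_form_on :: "'a set \<Rightarrow> ('a \<Rightarrow> 'a \<Rightarrow> 'f) \<Rightarrow> bool" where
  "symmetric_form_on V B \<longleftrightarrow> (\<forall>x\<in>V. \<forall>y\<in>V. B x y = B y x)"

text \<open>Only used for symmetric forms, for which the left and the right radical coincide.\<close>

definition nondegenerate_form_on :: "'a::zero set \<Rightarrow> ('a \<Rightarrow> 'a \<Rightarrow> 'f::zero) \<Rightarrow> bool" where
  "nondegenerate_form_on V B \<longleftrightarrow> (\<forall>x\<in>V. (\<forall>y\<in>V. B x y = 0) \<longrightarrow> x = 0)"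


section \<open>Quadratic Lie algebras\<close>

text \<open>
  The Lie algebra lives on a subspace \<open>L\<close> of an ambient vector space, because the
  tensor product below is a subspace. A Lie algebra that fills its type has
  \<open>L = UNIV\<close>. All Lie algebras are finite-dimensional.
\<close>

locale lie_algebra = vector_space scale
  for scale :: "'f::field \<Rightarrow> 'a::ab_group_add \<Rightarrow> 'a" +
  fixes L :: "'a set" and bracket :: "'a \<Rightarrow> 'a \<Rightarrow> 'a"
  assumes subspace_L: "subspace L"
    and finite_dim: "\<exists>A. finite A \<and> L = span A"
    and bracket_closed: "\<lbrakk>x \<in> L; y \<in> L\<rbrakk> \<Longrightarrow> bracket x y \<in> L"
    and bracket_bilinear: "bilinear_on scale L scale L scale bracket"
    and bracket_self: "x \<in> L \<Longrightarrow> bracket x x = 0"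
    and jacobi: "\<lbrakk>x \<in> L; y \<in> L; z \<in> L\<rbrakk> \<Longrightarrow>
      bracket x (bracket y z) + bracket y (bracket z x) + bracket z (bracket x y) = 0"

definition abelian_on :: "'a::zero set \<Rightarrow> ('a \<Rightarrow> 'a \<Rightarrow> 'a) \<Rightarrow> bool" where
  "abelian_on L bracket \<longleftrightarrow> (\<forall>x\<in>L. \<forall>y\<in>L. bracket x y = 0)"

definition invariant_metric ::
  "('f::field \<Rightarrow> 'a::ab_group_add \<Rightarrow> 'a) \<Rightarrow> 'a set \<Rightarrow> ('a \<Rightarrow> 'a \<Rightarrow> 'a) \<Rightarrow> ('a \<Rightarrow> 'a \<Rightarrow> 'f) \<Rightarrow> bool" where
  "invariant_metric scale L bracket B \<longleftrightarrow>
     bilinear_on scale L scale L (*) B \<and>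
     symmetric_form_on L B \<and>
     nondegenerate_form_on L B \<and>
     (\<forall>x\<in>L. \<forall>y\<in>L. \<forall>z\<in>L. B x (bracket y z) = B (bracket x y) z)"

locale quadratic_lie_algebra = lie_algebra scale L bracket
  for scale :: "'f::field \<Rightarrow> 'a::ab_group_add \<Rightarrow> 'a" and L bracket +
  fixes B :: "'a \<Rightarrow> 'a \<Rightarrow> 'f"
  assumes metric: "invariant_metric scale L bracket B"

definition lie_ideal ::
  "('f::field \<Rightarrow> 'a::ab_group_add \<Rightarrow> 'a) \<Rightarrow> 'a set \<Rightarrow> ('a \<Rightarrow> 'a \<Rightarrow> 'a) \<Rightarrow> 'a set \<Rightarrow> bool" where
  "lie_ideal scale L bracket I \<longleftrightarrow>
     module.subspace scale I \<and> I \<subseteq> L \<and> (\<forall>x\<in>L. \<forall>y\<in>I. bracket x y \<in> I)"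

definition indecomposable ::
  "('f::field \<Rightarrow> 'a::ab_group_add \<Rightarrow> 'a) \<Rightarrow> 'a set \<Rightarrow> ('a \<Rightarrow> 'a \<Rightarrow> 'a) \<Rightarrow> ('a \<Rightarrow> 'a \<Rightarrow> 'f) \<Rightarrow> bool" where
  "indecomposable scale L bracket B \<longleftrightarrow>
     \<not> (\<exists>I J. lie_ideal scale L bracket I \<and> lie_ideal scale L bracket J \<and>
          I \<noteq> {0} \<and> J \<noteq> {0} \<and>
          L = {x + y |x y. x \<in> I \<and> y \<in> J} \<and> I \<inter> J = {0} \<and>
          (\<forall>x\<in>I. \<forall>y\<in>J. B x y = 0))"


section \<open>Commutative associative algebras with unit\<close>

text \<open>
  Commutativity, associativity and the unit come from the sort of \<open>'s\<close>. The sort does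
  not include \<open>0 \<noteq> 1\<close>, so the zero algebra is allowed.
\<close>

locale comm_unital_algebra = vector_space scale
  for scale :: "'f::field \<Rightarrow> 's::{comm_ring, monoid_mult} \<Rightarrow> 's" +
  assumes scale_mult: "scale c (s * t) = scale c s * t"
    and finite_dim: "\<exists>A. finite A \<and> span A = UNIV"

definition invariant_form :: "('s::times \<Rightarrow> 's \<Rightarrow> 'f) \<Rightarrow> bool" where
  "invariant_form \<gamma> \<longleftrightarrow> (\<forall>s s' t. \<gamma> s (s' * t) = \<gamma> (s * s') t)"


section \<open>Tensor product and current Lie algebra\<close>

text \<open>
  A pure tensor is the evaluation of bilinear forms at a pair of vectors. The tensor
  product is the span of the pure tensors in the space of all functionals on
  \<open>'g \<Rightarrow> 's \<Rightarrow> 'f\<close>. Functions that are not bilinear are sent to \<open>0\<close>, so that they play no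
  role. The universal property is \<open>tensor_universal\<close> and \<open>tensor_universal_unique\<close> below.
\<close>

type_synonym ('g, 's, 'f) tensor = "('g \<Rightarrow> 's \<Rightarrow> 'f) \<Rightarrow> 'f"

definition tensor_scale :: "'f::field \<Rightarrow> ('g, 's, 'f) tensor \<Rightarrow> ('g, 's, 'f) tensor" where
  "tensor_scale c P = (\<lambda>\<beta>. c * P \<beta>)"

definition pure_tensor ::
  "('f::field \<Rightarrow> 'g::ab_group_add \<Rightarrow> 'g) \<Rightarrow> ('f \<Rightarrow> 's::ab_group_add \<Rightarrow> 's) \<Rightarrow> 'g \<Rightarrow> 's
    \<Rightarrow> ('g, 's, 'f) tensor" where
  "pure_tensor sg sS x s =
     (\<lambda>\<beta>. if bilinear_on sg UNIV sS UNIV (*) \<beta> then \<beta> x s else 0)"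

definition tensor_product ::
  "('f::field \<Rightarrow> 'g::ab_group_add \<Rightarrow> 'g) \<Rightarrow> ('f \<Rightarrow> 's::ab_group_add \<Rightarrow> 's)
    \<Rightarrow> ('g, 's, 'f) tensor set" where
  "tensor_product sg sS = module.span tensor_scale {pure_tensor sg sS x s |x s. True}"

text \<open>
  On pure tensors this formula gives \<open>[x \<otimes> s, y \<otimes> t] = [x, y] \<otimes> st\<close>; see
  \<open>current_bracket_pure\<close>, and \<open>current_bracket_unique\<close> for uniqueness.
\<close>

definition current_bracket ::
  "('f::field \<Rightarrow> 'g::ab_group_add \<Rightarrow> 'g) \<Rightarrow> ('f \<Rightarrow> 's::{comm_ring, monoid_mult} \<Rightarrow> 's)
    \<Rightarrow> ('g \<Rightarrow> 'g \<Rightarrow> 'g) \<Rightarrow> ('g, 's, 'f) tensor \<Rightarrow> ('g, 's, 'f) tensor \<Rightarrow> ('g, 's, 'f) tensor" where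
  "current_bracket sg sS bracket P Q =
     (\<lambda>\<beta>. if bilinear_on sg UNIV sS UNIV (*) \<beta>
          then P (\<lambda>x s. Q (\<lambda>y t. \<beta> (bracket x y) (s * t))) else 0)"

context
  notes plus_fun_apply [simp del] zero_fun_apply [simp del] minus_apply [simp del] uminus_apply [simp del]
begin

lemma vector_space_tensor_scale:
  "vector_space (tensor_scale :: 'f::field \<Rightarrow> ('g, 's, 'f) tensor \<Rightarrow> _)"
  by unfold_locales (auto simp: tensor_scale_def fun_eq_iff plus_fun_apply distrib_left distrib_right)

lemma vector_space_field: "vector_space ((*) :: 'f::field \<Rightarrow> 'f \<Rightarrow> 'f)"
  by unfold_locales (auto simp: algebra_simps)

lemma functionals_separate:
  assumes "vector_space (sW :: 'f::field \<Rightarrow> 'w::ab_group_add \<Rightarrow> 'w)"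
    and "\<And>\<phi>. Vector_Spaces.linear sW (*) \<phi> \<Longrightarrow> \<phi> v = \<phi> w"
  shows "v = w"
proof (rule ccontr)
  assume "v \<noteq> w"
  interpret W: vector_space_pair sW "(*) :: 'f \<Rightarrow> 'f \<Rightarrow> 'f"
    using assms(1) vector_space_field by (simp add: vector_space_pair_def)
  have "W.vs1.independent {v - w}"
    using \<open>v \<noteq> w\<close> W.vs1.dependent_single[of "v - w"] by simp
  from W.linear_independent_extend[OF this, of "\<lambda>_. 1"]
  obtain \<phi> where \<phi>: "Vector_Spaces.linear sW (*) \<phi>" "\<phi> (v - w) = 1" by auto
  from \<phi>(1) interpret Vector_Spaces.linear sW "(*)" \<phi> .
  show False using assms(2)[OF \<phi>(1)] \<phi>(2) by (simp add: diff)
qed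

lemma pure_tensor_bilinear:
  "bilinear_on sg UNIV sS UNIV tensor_scale (pure_tensor sg sS)"
  unfolding bilinear_on_def tensor_scale_def pure_tensor_def fun_eq_iff
  by (auto simp: bilinear_on_def plus_fun_apply)

lemma pure_tensor_in:
  fixes sg :: "'f::field \<Rightarrow> 'g::ab_group_add \<Rightarrow> 'g"
    and sS :: "'f \<Rightarrow> 's::ab_group_add \<Rightarrow> 's"
  shows "pure_tensor sg sS x s \<in> tensor_product sg sS"
proof -
  interpret vector_space "tensor_scale :: 'f \<Rightarrow> ('g, 's, 'f) tensor \<Rightarrow> _"
    by (rule vector_space_tensor_scale)
  show ?thesis unfolding tensor_product_def by (rule span_base) auto
qed

lemma tensor_universal:
  fixes sg :: "'f::field \<Rightarrow> 'g::ab_group_add \<Rightarrow> 'g"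
    and sS :: "'f \<Rightarrow> 's::ab_group_add \<Rightarrow> 's"
    and sW :: "'f \<Rightarrow> 'w::ab_group_add \<Rightarrow> 'w"
  assumes W: "vector_space sW" and f: "bilinear_on sg UNIV sS UNIV sW f"
  shows "\<exists>F. Vector_Spaces.linear tensor_scale sW F \<and> (\<forall>x s. F (pure_tensor sg sS x s) = f x s)"
proof -
  interpret p: vector_space_pair "tensor_scale :: 'f \<Rightarrow> ('g, 's, 'f) tensor \<Rightarrow> _" sW
    using vector_space_tensor_scale W by (simp add: vector_space_pair_def)
  interpret q: vector_space_pair "tensor_scale :: 'f \<Rightarrow> ('g, 's, 'f) tensor \<Rightarrow> _" "(*) :: 'f \<Rightarrow> 'f \<Rightarrow> 'f"
    using vector_space_tensor_scale vector_space_field by (simp add: vector_space_pair_def)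
  let ?P = "{pure_tensor sg sS x s |x s. True}"
  obtain C where C: "C \<subseteq> ?P" "p.vs1.independent C" "?P \<subseteq> p.vs1.span C"
    using p.vs1.maximal_independent_subset[of ?P] by blast
  have "\<forall>b\<in>C. \<exists>y. b = pure_tensor sg sS (fst y) (snd y)" using C(1) by fastforce
  then obtain r where r: "\<And>b. b \<in> C \<Longrightarrow> b = pure_tensor sg sS (fst (r b)) (snd (r b))"
    by metis
  obtain F where F: "Vector_Spaces.linear tensor_scale sW F"
    and Fb: "\<And>b. b \<in> C \<Longrightarrow> F b = f (fst (r b)) (snd (r b))"
    using p.linear_independent_extend[OF C(2), of "\<lambda>b. f (fst (r b)) (snd (r b))"] by auto
  have "F (pure_tensor sg sS x s) = f x s" for x s
  proof (rule functionals_separate[OF W])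
    fix \<phi> assume \<phi>: "Vector_Spaces.linear sW ((*) :: 'f \<Rightarrow> 'f \<Rightarrow> 'f) \<phi>"
    let ?\<beta> = "\<lambda>x s. \<phi> (f x s)"
    interpret L: Vector_Spaces.linear sW "(*)" \<phi> by fact
    have b: "bilinear_on sg UNIV sS UNIV (*) ?\<beta>"
      using f unfolding bilinear_on_def by (simp add: L.add L.scale)
    have l1: "Vector_Spaces.linear tensor_scale (*) (\<phi> \<circ> F)" by (rule Vector_Spaces.linear_compose[OF F \<phi>])
    have l2: "Vector_Spaces.linear tensor_scale (*) (\<lambda>Q. Q ?\<beta>)"
      using q.vector_space_pair_axioms
      by (simp add: Vector_Spaces.linear_iff vector_space_pair_def tensor_scale_def plus_fun_apply)
    have "(\<phi> \<circ> F) (pure_tensor sg sS x s) = pure_tensor sg sS x s ?\<beta>"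
    proof (rule q.linear_eq_on[OF l1 l2])
      show "pure_tensor sg sS x s \<in> p.vs1.span C" using C(3) by blast
      show "(\<phi> \<circ> F) Q = Q ?\<beta>" if "Q \<in> C" for Q
      proof -
        have "Q ?\<beta> = pure_tensor sg sS (fst (r Q)) (snd (r Q)) ?\<beta>"
          using r[OF that] by simp
        then show ?thesis using Fb[OF that] b by (simp add: pure_tensor_def)
      qed
    qed
    then show "\<phi> (F (pure_tensor sg sS x s)) = \<phi> (f x s)" using b by (simp add: pure_tensor_def)
  qed
  with F show ?thesis by blast
qed

lemma tensor_product_induct [consumes 1, case_names zero add]:
  fixes sg :: "'f::field \<Rightarrow> 'g::ab_group_add \<Rightarrow> 'g"
    and sS :: "'f \<Rightarrow> 's::ab_group_add \<Rightarrow> 's"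
  assumes "P \<in> tensor_product sg sS"
    and "X 0"
    and "\<And>c x s Q. Q \<in> tensor_product sg sS \<Longrightarrow> X Q \<Longrightarrow>
        X (tensor_scale c (pure_tensor sg sS x s) + Q)"
  shows "X P"
proof -
  interpret vector_space "tensor_scale :: 'f \<Rightarrow> ('g, 's, 'f) tensor \<Rightarrow> _"
    by (rule vector_space_tensor_scale)
  have "X P \<and> P \<in> tensor_product sg sS"
    using assms(1)[unfolded tensor_product_def]
  proof (induction rule: span_induct_alt)
    case base
    then show ?case using assms(2) span_zero by (simp add: tensor_product_def)
  next
    case (step c y z)
    then show ?case
      using assms(3) pure_tensor_in[of sg sS] span_add span_scale
      unfolding tensor_product_def by blast
  qed
  then show ?thesis ..
qed

lemma tensor_universal_unique:
  fixes sg :: "'f::field \<Rightarrow> 'g::ab_group_add \<Rightarrow> 'g"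
    and sS :: "'f \<Rightarrow> 's::ab_group_add \<Rightarrow> 's"
  assumes "Vector_Spaces.linear tensor_scale sW F" "Vector_Spaces.linear tensor_scale sW G"
    and "\<And>x s. F (pure_tensor sg sS x s) = G (pure_tensor sg sS x s)"
    and "P \<in> tensor_product sg sS"
  shows "F P = G P"
proof -
  interpret F: Vector_Spaces.linear tensor_scale sW F by fact
  interpret G: Vector_Spaces.linear tensor_scale sW G by fact
  show ?thesis using assms(4)
    by (induction rule: tensor_product_induct)
       (simp_all add: F.zero G.zero F.add G.add F.scale G.scale assms(3))
qed

lemma tensor_product_subspace:
  fixes sg :: "'f::field \<Rightarrow> 'g::ab_group_add \<Rightarrow> 'g"
    and sS :: "'f \<Rightarrow> 's::ab_group_add \<Rightarrow> 's"
  shows "module.subspace tensor_scale (tensor_product sg sS)"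
proof -
  interpret vector_space "tensor_scale :: 'f \<Rightarrow> ('g, 's, 'f) tensor \<Rightarrow> _"
    by (rule vector_space_tensor_scale)
  show ?thesis unfolding tensor_product_def by (rule subspace_span)
qed

context
  fixes sg :: "'f::field \<Rightarrow> 'g::ab_group_add \<Rightarrow> 'g"
    and sS :: "'f \<Rightarrow> 's::{comm_ring, monoid_mult} \<Rightarrow> 's"
    and bracket :: "'g \<Rightarrow> 'g \<Rightarrow> 'g"
  assumes G: "lie_algebra sg UNIV bracket" and S: "comm_unital_algebra sS"
begin

interpretation G: lie_algebra sg UNIV bracket by (rule G)
interpretation S: comm_unital_algebra sS by (rule S)
interpretation T: vector_space "tensor_scale :: 'f \<Rightarrow> ('g, 's, 'f) tensor \<Rightarrow> _"
  by (rule vector_space_tensor_scale)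

private abbreviation (input) "tens \<equiv> pure_tensor sg sS"
private abbreviation (input) "TP \<equiv> tensor_product sg sS"
private abbreviation (input) "br \<equiv> current_bracket sg sS bracket"

lemma br_simps:
  "bracket (x + x') y = bracket x y + bracket x' y"
  "bracket x (y + y') = bracket x y + bracket x y'"
  "bracket (sg c x) y = sg c (bracket x y)"
  "bracket x (sg c y) = sg c (bracket x y)"
  using G.bracket_bilinear unfolding bilinear_on_def by auto

lemma mult_simps: "sS c s * t = sS c (s * t)" "s * sS c t = sS c (s * t)"
  using S.scale_mult[of c] by (metis mult.commute)+

lemma inner_bilinear:
  assumes "bilinear_on sg UNIV sS UNIV (*) \<beta>"
  shows "bilinear_on sg UNIV sS UNIV (*) (\<lambda>y t. \<beta> (bracket x y) (s * t))"
    and "bilinear_on sg UNIV sS UNIV (*) (\<lambda>x s. \<beta> (bracket x y) (s * t))"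
  using assms unfolding bilinear_on_def by (auto simp: br_simps mult_simps algebra_simps)

theorem current_bracket_pure:
  "current_bracket sg sS bracket (pure_tensor sg sS x s) (pure_tensor sg sS y t) =
     pure_tensor sg sS (bracket x y) (s * t)"
  by (auto simp: current_bracket_def pure_tensor_def inner_bilinear)

lemma current_bracket_add_left: "br (P + P') Q = br P Q + br P' Q"
  and current_bracket_scale_left: "br (tensor_scale c P) Q = tensor_scale c (br P Q)"
  and current_bracket_zero_left: "br 0 Q = 0"
  by (auto simp: current_bracket_def fun_eq_iff tensor_scale_def plus_fun_apply zero_fun_apply)

lemma current_bracket_pure_left:
  "br (tens x s) (Q + Q') = br (tens x s) Q + br (tens x s) Q'"
  "br (tens x s) (tensor_scale c Q) = tensor_scale c (br (tens x s) Q)"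
  "br (tens x s) 0 = 0"
  if "Q \<in> TP" "Q' \<in> TP"
proof -
  have lin: "bilinear_on sg UNIV sS UNIV (*) (\<lambda>x s. R (\<lambda>y t. \<beta> (bracket x y) (s * t)))"
    if "bilinear_on sg UNIV sS UNIV (*) \<beta>" "R \<in> TP" for R \<beta>
    using that(2)
  proof (induction rule: tensor_product_induct)
    case zero
    then show ?case by (simp add: bilinear_on_def zero_fun_apply)
  next
    case (add c y t Q)
    have "(\<lambda>x s. (tensor_scale c (tens y t) + Q) (\<lambda>y t. \<beta> (bracket x y) (s * t))) =
      (\<lambda>x s. c * \<beta> (bracket x y) (s * t) + Q (\<lambda>y t. \<beta> (bracket x y) (s * t)))"
      using inner_bilinear(1)[OF that(1)]
      by (simp add: tensor_scale_def pure_tensor_def plus_fun_apply)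
    moreover have "bilinear_on sg UNIV sS UNIV (*)
      (\<lambda>x s. c * \<beta> (bracket x y) (s * t) + Q (\<lambda>y t. \<beta> (bracket x y) (s * t)))"
      using add(2) inner_bilinear(2)[OF that(1), of y t]
      unfolding bilinear_on_def by (simp add: distrib_left distrib_right add_ac mult.left_commute)
    ultimately show ?case by simp
  qed
  have mem: "Q + Q' \<in> TP" "tensor_scale c Q \<in> TP" "0 \<in> TP"
    using that tensor_product_subspace[of sg sS] T.subspace_add T.subspace_scale T.subspace_0 by blast+
  have val: "br (tens x s) R \<beta> = R (\<lambda>y t. \<beta> (bracket x y) (s * t))"
    if "bilinear_on sg UNIV sS UNIV (*) \<beta>" "R \<in> TP" for R \<beta>
    using lin[OF that] that(1) by (simp add: current_bracket_def pure_tensor_def)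
  have no: "br P R \<beta> = 0" if "\<not> bilinear_on sg UNIV sS UNIV (*) \<beta>" for P R \<beta>
    using that by (simp add: current_bracket_def)
  show "br (tens x s) (Q + Q') = br (tens x s) Q + br (tens x s) Q'"
  proof
    fix \<beta> show "br (tens x s) (Q + Q') \<beta> = (br (tens x s) Q + br (tens x s) Q') \<beta>"
      by (cases "bilinear_on sg UNIV sS UNIV (*) \<beta>") (simp_all add: val mem that no plus_fun_apply zero_fun_apply)
  qed
  show "br (tens x s) (tensor_scale c Q) = tensor_scale c (br (tens x s) Q)"
  proof
    fix \<beta>
    have sc: "tensor_scale c R b = c * R b" for R :: "('g, 's, 'f) tensor" and b
      by (simp add: tensor_scale_def)
    show "br (tens x s) (tensor_scale c Q) \<beta> = tensor_scale c (br (tens x s) Q) \<beta>"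
      by (cases "bilinear_on sg UNIV sS UNIV (*) \<beta>") (simp_all add: val mem that no sc)
  qed
  show "br (tens x s) 0 = 0"
  proof
    fix \<beta> show "br (tens x s) 0 \<beta> = 0 \<beta>"
      by (cases "bilinear_on sg UNIV sS UNIV (*) \<beta>") (simp_all add: val mem no zero_fun_apply)
  qed
qed

lemma current_bracket_right:
  assumes "P \<in> TP" "Q \<in> TP" "Q' \<in> TP"
  shows "br P (Q + Q') = br P Q + br P Q'"
    and "br P (tensor_scale c Q) = tensor_scale c (br P Q)"
    and "br P 0 = 0"
proof -
  have "br P (Q + Q') = br P Q + br P Q' \<and> br P (tensor_scale c Q) = tensor_scale c (br P Q)
    \<and> br P 0 = 0"
    using assms(1)
  proof (induction rule: tensor_product_induct)
    case zero
    then show ?case by (simp add: current_bracket_zero_left)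
  next
    case (add d x s R)
    then show ?case
      by (simp add: current_bracket_add_left current_bracket_scale_left
            current_bracket_pure_left[OF assms(2,3)] T.scale_right_distrib T.scale_left_commute)
  qed
  then show "br P (Q + Q') = br P Q + br P Q'"
    and "br P (tensor_scale c Q) = tensor_scale c (br P Q)" and "br P 0 = 0" by auto
qed

lemma TP_closed: "P \<in> TP \<Longrightarrow> Q \<in> TP \<Longrightarrow> P + Q \<in> TP" "P \<in> TP \<Longrightarrow> tensor_scale c P \<in> TP" "0 \<in> TP"
  using tensor_product_subspace[of sg sS] T.subspace_add T.subspace_scale T.subspace_0 by blast+

theorem current_bracket_bilinear:
  "bilinear_on tensor_scale (tensor_product sg sS) tensor_scale (tensor_product sg sS)
     tensor_scale (current_bracket sg sS bracket)"
  unfolding bilinear_on_def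
  by (auto simp: current_bracket_add_left current_bracket_scale_left current_bracket_right)

theorem current_bracket_unique:
  assumes h: "bilinear_on tensor_scale (tensor_product sg sS) tensor_scale (tensor_product sg sS)
      tensor_scale h"
    and pure: "\<And>x s y t. h (pure_tensor sg sS x s) (pure_tensor sg sS y t) =
      pure_tensor sg sS (bracket x y) (s * t)"
    and P: "P \<in> tensor_product sg sS" and Q: "Q \<in> tensor_product sg sS"
  shows "h P Q = current_bracket sg sS bracket P Q"
proof -
  have h': "h (A + A') C = h A C + h A' C" "h A (C + C') = h A C + h A C'"
    "h (tensor_scale c A) C = tensor_scale c (h A C)"
    "h A (tensor_scale c C) = tensor_scale c (h A C)"
    if "A \<in> TP" "A' \<in> TP" "C \<in> TP" "C' \<in> TP" for A A' C C' c
    using h that unfolding bilinear_on_def by blast+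
  have h0: "h A 0 = 0" "h 0 A = 0" if "A \<in> TP" for A
    using h'(3)[of 0 0 A A 0] h'(4)[of A A 0 0 0] that TP_closed(3) by auto
  have 1: "h (tens x s) Q = br (tens x s) Q" for x s
    using Q
  proof (induction rule: tensor_product_induct)
    case zero
    then show ?case by (simp add: h0 pure_tensor_in current_bracket_right(3)[OF _ TP_closed(3) TP_closed(3)])
  next
    case (add c y t R)
    have [simp]: "tens x s \<in> TP" "tens y t \<in> TP" by (rule pure_tensor_in)+
    show ?case using add
      by (simp add: h'(2)[of _ 0] h'(4)[of _ 0 _ 0] TP_closed current_bracket_right(1)
          current_bracket_right(2)[of _ _ 0] pure current_bracket_pure)
  qed
  show ?thesis using P
  proof (induction rule: tensor_product_induct)
    case zero
    then show ?case by (simp add: h0 Q current_bracket_zero_left)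
  next
    case (add c y t R)
    have [simp]: "tens y t \<in> TP" by (rule pure_tensor_in)
    show ?case using add Q
      by (simp add: h'(1)[of _ _ _ 0] h'(3)[of _ 0 _ 0] TP_closed 1
          current_bracket_add_left current_bracket_scale_left)
  qed
qed

lemma br_neg: "bracket x y = - bracket y x"
proof -
  have "bracket (x + y) (x + y) = 0" "bracket x x = 0" "bracket y y = 0"
    using G.bracket_self by auto
  then have "bracket x y + bracket y x = 0" by (simp add: br_simps add.commute)
  then show ?thesis by (simp add: eq_neg_iff_add_eq_0)
qed

lemma pure_simps:
  "tens (x + x') s = tens x s + tens x' s" "tens x (s + s') = tens x s + tens x s'"
  "tens (sg c x) s = tensor_scale c (tens x s)" "tens x (sS c s) = tensor_scale c (tens x s)"
  using pure_tensor_bilinear[of sg sS] unfolding bilinear_on_def by auto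

lemma pure_zero: "tens 0 s = 0" "tens x 0 = 0"
  using pure_simps(3)[of 0 0 s] pure_simps(4)[of x 0 0] by auto

lemma pure_neg: "tens (- x) s = - tens x s"
  using pure_simps(1)[of x "- x" s] by (simp add: pure_zero add_eq_0_iff)

lemma current_bracket_closed:
  assumes "P \<in> TP" "Q \<in> TP"
  shows "br P Q \<in> TP"
  using assms(1)
proof (induction rule: tensor_product_induct)
  case zero
  then show ?case by (simp add: current_bracket_zero_left TP_closed)
next
  case (add c x s R)
  have "br (tens x s) Q \<in> TP" using assms(2)
  proof (induction rule: tensor_product_induct)
    case zero
    then show ?case
      by (simp add: current_bracket_right(3)[OF _ TP_closed(3) TP_closed(3)] pure_tensor_in TP_closed)
  next
    case (add d y t R)
    then show ?case
      by (simp add: current_bracket_right(1) current_bracket_right(2)[of _ _ 0] pure_tensor_in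
          TP_closed current_bracket_pure)
  qed
  with add show ?case
    by (simp add: current_bracket_add_left current_bracket_scale_left TP_closed)
qed

lemma current_bracket_skew:
  assumes "P \<in> TP" "Q \<in> TP"
  shows "br P Q = - br Q P"
  using assms(1)
proof (induction rule: tensor_product_induct)
  case zero
  then show ?case
    by (simp add: current_bracket_zero_left
        current_bracket_right(3)[OF assms(2) TP_closed(3) TP_closed(3)])
next
  case (add c x s R)
  have "br (tens x s) Q = - br Q (tens x s)" using assms(2)
  proof (induction rule: tensor_product_induct)
    case zero
    then show ?case
      by (simp add: current_bracket_zero_left
          current_bracket_right(3)[OF _ TP_closed(3) TP_closed(3)] pure_tensor_in)
  next
    case (add d y t R)
    have "tens (bracket x y) (s * t) = - tens (bracket y x) (t * s)"
      using br_neg[of x y] by (simp add: pure_neg mult.commute)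
    with add show ?case
      by (simp add: current_bracket_right(1) current_bracket_right(2)[of _ _ 0] pure_tensor_in
          TP_closed current_bracket_pure current_bracket_add_left current_bracket_scale_left)
  qed
  with add assms(2) show ?case
    by (simp add: current_bracket_add_left current_bracket_scale_left TP_closed pure_tensor_in
        current_bracket_right(1) current_bracket_right(2)[of _ _ 0])
qed

lemma current_bracket_self:
  assumes "P \<in> TP"
  shows "br P P = 0"
  using assms
proof (induction rule: tensor_product_induct)
  case zero
  then show ?case by (simp add: current_bracket_zero_left)
next
  case (add c x s R)
  have "br (tens x s) (tens x s) = 0"
    using G.bracket_self by (simp add: current_bracket_pure pure_zero)
  moreover have "br (tens x s) R = - br R (tens x s)"
    using add current_bracket_skew pure_tensor_in by blast
  ultimately show ?case using add
    by (simp add: current_bracket_add_left current_bracket_scale_left TP_closed pure_tensor_in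
        current_bracket_right(1) current_bracket_right(2)[of _ _ 0])
qed

lemma current_bracket_jacobi:
  assumes "P \<in> TP" "Q \<in> TP" "R \<in> TP"
  shows "br P (br Q R) + br Q (br R P) + br R (br P Q) = 0"
proof -
  define jac where "jac P Q R = br P (br Q R) + br Q (br R P) + br R (br P Q)" for P Q R
  have rot: "jac P Q R = jac Q R P" for P Q R by (simp add: jac_def ac_simps)
  have z: "jac 0 Q R = 0" if "Q \<in> TP" "R \<in> TP" for Q R
    using that by (simp add: jac_def current_bracket_zero_left
        current_bracket_right(3)[OF _ TP_closed(3) TP_closed(3)])
  have step: "jac (tensor_scale c (tens x s) + P) Q R = tensor_scale c (jac (tens x s) Q R) + jac P Q R"
    if "P \<in> TP" "Q \<in> TP" "R \<in> TP" for c x s P Q R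
    using that by (simp add: jac_def current_bracket_add_left current_bracket_scale_left
        current_bracket_right(1) current_bracket_right(2)[of _ _ 0] TP_closed pure_tensor_in
        current_bracket_closed T.scale_right_distrib)
  have red: "jac P Q R = 0"
    if "\<And>x s. jac (tens x s) Q R = 0" "P \<in> TP" "Q \<in> TP" "R \<in> TP" for P Q R
    using that(2) by (induction rule: tensor_product_induct) (simp_all add: z step that)
  have pure: "jac (tens x s) (tens y t) (tens z u) = 0" for x s y t z u
  proof -
    have "jac (tens x s) (tens y t) (tens z u) =
      tens (bracket x (bracket y z) + bracket y (bracket z x) + bracket z (bracket x y)) (s * t * u)"
      by (simp add: jac_def current_bracket_pure pure_simps(1) mult_ac)
    then show ?thesis using G.jacobi by (simp add: pure_zero)
  qed
  have p2: "jac (tens y t) (tens z u) P = 0" if "P \<in> TP" for y t z u P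
    using red[of "tens y t" "tens z u" P] that pure pure_tensor_in rot by metis
  have p1: "jac (tens z u) P Q = 0" if "P \<in> TP" "Q \<in> TP" for z u P Q
    using red[of "tens z u" P Q] p2 that pure_tensor_in rot by metis
  show ?thesis using red[of Q R P] p1 assms by (simp add: jac_def)
qed

lemma tensor_product_finite_dim:
  "\<exists>A. finite A \<and> tensor_product sg sS = module.span tensor_scale A"
proof -
  obtain A where A: "finite A" "UNIV = G.span A" using G.finite_dim by blast
  obtain C where C: "finite C" "S.span C = UNIV" using S.finite_dim by blast
  let ?D = "(\<lambda>(x, s). tens x s) ` (A \<times> C)"
  have 1: "tens x s \<in> T.span ?D" if "x \<in> A" for x s
  proof -
    have "s \<in> S.span C" using C by auto
    then show ?thesis
    proof (induction rule: S.span_induct_alt)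
      case base
      then show ?case by (simp add: pure_zero T.span_zero)
    next
      case (step c y z)
      have "tens x y \<in> T.span ?D" using that step by (intro T.span_base) force
      with step show ?case by (simp add: pure_simps T.span_add T.span_scale)
    qed
  qed
  have 2: "tens x s \<in> T.span ?D" for x s
  proof -
    have "x \<in> G.span A" using A by auto
    then show ?thesis
    proof (induction rule: G.span_induct_alt)
      case base
      then show ?case by (simp add: pure_zero T.span_zero)
    next
      case (step c y z)
      with 1 show ?case by (simp add: pure_simps T.span_add T.span_scale)
    qed
  qed
  have "TP = T.span ?D"
  proof
    show "TP \<subseteq> T.span ?D"
      unfolding tensor_product_def using 2 by (intro T.span_minimal) auto
    show "T.span ?D \<subseteq> TP"
      using pure_tensor_in tensor_product_subspace by (intro T.span_minimal) auto
  qed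
  moreover have "finite ?D" using A C by simp
  ultimately show ?thesis by blast
qed

theorem current_lie_algebra:
  "lie_algebra tensor_scale (tensor_product sg sS) (current_bracket sg sS bracket)"
  by unfold_locales
     (use tensor_product_subspace tensor_product_finite_dim current_bracket_closed
        current_bracket_bilinear current_bracket_self current_bracket_jacobi in blast)+

end

end

end

theory Submission
  imports Defs
begin

text \<open>
  For the harder direction, let \<open>\<langle>\<cdot>,\<cdot>\<rangle>\<close> be an invariant metric on \<open>g \<otimes> S\<close> and represent the forms
  \<open>\<langle>x \<otimes> s, y \<otimes> t\<rangle> = B (D s t x) y\<close>. Invariance gives \<open>D (st) u [x, y] = [D s (tu) x, y]\<close>. Hence all
  \<open>D s t\<close> lie in the centroid, they commute on \<open>[g, g]\<close>, and there \<open>D s t = D 1 (st)\<close>. Since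
  \<open>[g, g] \<noteq> 0\<close>, there is a common eigenvector \<open>w \<in> [g, g]\<close>, say \<open>D 1 u w = l(u) w\<close>. The form
  \<open>\<gamma>(s, t) = l(st)\<close> is non-degenerate: if \<open>l(st) = 0\<close> for all \<open>t\<close>, then \<open>w \<otimes> s\<close> is orthogonal to
  everything, so \<open>w \<otimes> s = 0\<close> and \<open>s = 0\<close>. Conversely, \<open>B \<otimes> \<gamma>\<close> is an invariant metric.
\<close>

section \<open>Common eigenvectors of commuting endomorphisms\<close>

text \<open>This is the vector p(T) v, computed by Horner's scheme. Carrying \<open>v\<close> along
  keeps every intermediate value a vector, so the ring of endomorphisms never enters.\<close>

definition poly_apply ::
  "('f::comm_ring_1 \<Rightarrow> 'a::ab_group_add \<Rightarrow> 'a) \<Rightarrow> ('a \<Rightarrow> 'a) \<Rightarrow> 'a \<Rightarrow> 'f poly \<Rightarrow> 'a" where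
  "poly_apply scale T v p = fold_coeffs (\<lambda>a u. scale a v + T u) p 0"

context vector_space
begin

context
  fixes T :: "'b \<Rightarrow> 'b" and v :: 'b
  assumes T: "Vector_Spaces.linear scale scale T"
begin

interpretation T: Vector_Spaces.linear scale scale T by (rule T)

lemma poly_apply_0: "poly_apply scale T v 0 = 0"
  by (simp add: poly_apply_def)

lemma poly_apply_pCons: "poly_apply scale T v (pCons a p) = scale a v + T (poly_apply scale T v p)"
  by (cases "p = 0"; cases "a = 0") (auto simp: poly_apply_def T.zero)

lemma poly_apply_add: "poly_apply scale T v (p + q) = poly_apply scale T v p + poly_apply scale T v q"
  by (induction p q rule: poly_induct2)
     (simp_all add: poly_apply_0 poly_apply_pCons T.add scale_left_distrib add_ac)

lemma poly_apply_smult: "poly_apply scale T v (smult c p) = scale c (poly_apply scale T v p)"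
  by (induction p) (simp_all add: poly_apply_0 poly_apply_pCons T.scale scale_right_distrib)

lemma poly_apply_sum: "poly_apply scale T v (sum f A) = (\<Sum>i\<in>A. poly_apply scale T v (f i))"
  by (induction A rule: infinite_finite_induct) (simp_all add: poly_apply_0 poly_apply_add)

lemma poly_apply_monom: "poly_apply scale T v (monom a i) = scale a ((T ^^ i) v)"
  by (induction i) (simp_all add: monom_0 monom_Suc poly_apply_0 poly_apply_pCons T.zero T.scale)

text \<open>Multiplication by X becomes an application of \<open>T\<close>. A linear factor split
  off from an annihilating polynomial of \<open>v\<close> thus becomes the operator T - c applied to
  q(T) v.\<close>

lemma poly_apply_linear_factor:
  "poly_apply scale T v ([:-c, 1:] * q) = T (poly_apply scale T v q) - scale c (poly_apply scale T v q)"
proof -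
  have "[:-c, 1:] * q = smult (-c) q + pCons 0 q" by simp
  then show ?thesis by (simp only: poly_apply_add poly_apply_smult poly_apply_pCons) simp
qed

lemma poly_apply_in_subspace:
  assumes "subspace W" "v \<in> W" "T ` W \<subseteq> W"
  shows "poly_apply scale T v p \<in> W"
  by (induction p)
     (use assms in \<open>auto simp: poly_apply_0 poly_apply_pCons intro: subspace_0 subspace_add subspace_scale\<close>)

end

end

text \<open>Indexing by numbers, with repetitions allowed, lets a relation among iterates of an
  operator be read as a polynomial. If \<open>f\<close> is injective, dim + 1 of its values are
  dependent; otherwise two equal terms cancel.\<close>

lemma (in finite_dimensional_vector_space) nontrivial_relation:
  fixes f :: "nat \<Rightarrow> 'b"
  shows "\<exists>u n. (\<exists>i\<le>n. u i \<noteq> 0) \<and> (\<Sum>i\<le>n. scale (u i) (f i)) = 0"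
proof (cases "inj f")
  case True
  let ?n = "card Basis"
  have inj: "inj_on f {..?n}" using True by (rule inj_on_subset) simp
  then have "card (f ` {..?n}) = Suc ?n" by (simp add: card_image)
  then have "dependent (f ` {..?n})"
    using independent_bound_general[of "f ` {..?n}"] dim_subset_UNIV[of "f ` {..?n}"]
    by (auto simp: dimension_def)
  then obtain u v where u: "v \<in> f ` {..?n}" "u v \<noteq> 0" "(\<Sum>v\<in>f ` {..?n}. scale (u v) v) = 0"
    using dependent_finite[of "f ` {..?n}"] by auto
  then have "(\<Sum>i\<le>?n. scale ((u \<circ> f) i) (f i)) = 0"
    by (simp add: sum.reindex[OF inj])
  moreover obtain i where "i \<le> ?n" "v = f i" using u(1) by auto
  ultimately show ?thesis using u(2) by (intro exI[of _ "u \<circ> f"] exI[of _ ?n]) auto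
next
  case False
  then obtain i j where ij: "f i = f j" "i < j" unfolding inj_def by (metis linorder_neqE_nat)
  let ?u = "\<lambda>k. if k = i then 1 else if k = j then -1 else 0"
  have "(\<Sum>k\<le>j. scale (?u k) (f k)) = (\<Sum>k\<in>{i, j}. scale (?u k) (f k))"
    using ij by (intro sum.mono_neutral_right) auto
  also have "\<dots> = 0" using ij by simp
  finally show ?thesis using ij by (intro exI[of _ ?u] exI[of _ j]) auto
qed

text \<open>Induction on the degree. A root c gives p = (X - c) q, so T - c kills q(T) v. Either
  that vector is an eigenvector, or it is 0 and \<open>q\<close> annihilates \<open>v\<close> in
  smaller degree. A nonzero constant cannot annihilate the nonzero \<open>v\<close>.\<close>

lemma annihilated_imp_eigenvector:
  fixes scale :: "'f::alg_closed_field \<Rightarrow> 'a::ab_group_add \<Rightarrow> 'a"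
  assumes "vector_space scale" and T: "Vector_Spaces.linear scale scale T"
    and W: "module.subspace scale W" "T ` W \<subseteq> W" and v: "v \<in> W" "v \<noteq> 0"
    and p: "p \<noteq> 0" "poly_apply scale T v p = 0"
  shows "\<exists>w\<in>W. w \<noteq> 0 \<and> (\<exists>c. T w = scale c w)"
  using p
proof (induction "degree p" arbitrary: p rule: less_induct)
  case less
  interpret vector_space scale by fact
  interpret T: Vector_Spaces.linear scale scale T by (rule T)
  show ?case
  proof (cases "degree p = 0")
    case True
    then obtain a where "p = [:a:]" using degree_eq_zeroE by blast
    moreover have "T 0 = 0" by (rule T.zero)
    ultimately show ?thesis
      using less.prems v by (simp add: poly_apply_pCons[OF T] poly_apply_0[OF T])
  next
    case False
    then obtain c where "poly p c = 0" using alg_closed_imp_poly_has_root[of p] by auto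
    then obtain q where q: "p = [:-c, 1:] * q" by (auto simp: poly_eq_0_iff_dvd)
    with less.prems have "q \<noteq> 0" by auto
    with q have deg: "degree q < degree p" by (simp add: degree_mult_eq del: mult_pCons_left)
    let ?w = "poly_apply scale T v q"
    have "T ?w = scale c ?w"
      using less.prems(2) unfolding q poly_apply_linear_factor[OF T] by simp
    moreover have "?w \<in> W" using poly_apply_in_subspace[OF T W(1) v(1) W(2)] .
    ultimately show ?thesis using less.hyps[OF deg \<open>q \<noteq> 0\<close>] by blast
  qed
qed

text \<open>The iterates of \<open>T\<close> at a nonzero vector of \<open>W\<close> satisfy a
  linear relation, whose coefficients form an annihilating polynomial.\<close>

lemma eigenvector_exists:
  fixes scale :: "'f::alg_closed_field \<Rightarrow> 'a::ab_group_add \<Rightarrow> 'a"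
  assumes fd: "finite_dimensional_vector_space scale Basis"
    and T: "Vector_Spaces.linear scale scale T"
    and W: "module.subspace scale W" "T ` W \<subseteq> W" "W \<noteq> {0}"
  shows "\<exists>w\<in>W. w \<noteq> 0 \<and> (\<exists>c. T w = scale c w)"
proof -
  interpret finite_dimensional_vector_space scale Basis by fact
  obtain v where v: "v \<in> W" "v \<noteq> 0" using W subspace_0 by blast
  obtain u n i where u: "i \<le> n" "u i \<noteq> 0" "(\<Sum>i\<le>n. scale (u i) ((T ^^ i) v)) = 0"
    using nontrivial_relation[of "\<lambda>i. (T ^^ i) v"] by blast
  define p where "p = (\<Sum>i\<le>n. monom (u i) i)"
  have "coeff p i = u i" using u by (simp add: p_def coeff_sum)
  then have "p \<noteq> 0" using u by auto
  moreover have "poly_apply scale T v p = 0"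
    using u(3) by (simp add: p_def poly_apply_sum[OF T] poly_apply_monom[OF T])
  ultimately show ?thesis
    using annihilated_imp_eigenvector[OF vector_space_axioms T W(1,2) v] by blast
qed

text \<open>Induction on the dimension of \<open>W\<close>. If every operator is scalar on
  \<open>W\<close>, any nonzero vector serves. Otherwise some operator has an eigenspace in
  \<open>W\<close> that is nonzero and proper, and the whole family preserves it by commutation.
  \<open>F\<close> may be infinite.\<close>

lemma common_eigenvector_exists:
  fixes scale :: "'f::alg_closed_field \<Rightarrow> 'a::ab_group_add \<Rightarrow> 'a"
  assumes fd: "finite_dimensional_vector_space scale Basis"
    and lin: "\<And>T. T \<in> F \<Longrightarrow> Vector_Spaces.linear scale scale T"
    and W: "module.subspace scale W" "W \<noteq> {0}" "\<And>T. T \<in> F \<Longrightarrow> T ` W \<subseteq> W"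
    and comm: "\<And>S T x. S \<in> F \<Longrightarrow> T \<in> F \<Longrightarrow> x \<in> W \<Longrightarrow> S (T x) = T (S x)"
  shows "\<exists>w\<in>W. w \<noteq> 0 \<and> (\<forall>T\<in>F. \<exists>c. T w = scale c w)"
  using W comm
proof (induction "vector_space.dim scale W" arbitrary: W rule: less_induct)
  case less
  interpret finite_dimensional_vector_space scale Basis by fact
  show ?case
  proof (cases "\<forall>T\<in>F. \<exists>c. \<forall>w\<in>W. T w = scale c w")
    case True
    moreover obtain w where "w \<in> W" "w \<noteq> 0" using less.prems(1,2) subspace_0 by blast
    ultimately show ?thesis by (intro bexI[of _ w] conjI ballI) auto
  next
    case False
    then obtain T where T: "T \<in> F" "\<And>c. \<exists>w\<in>W. T w \<noteq> scale c w" by blast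
    interpret T: Vector_Spaces.linear scale scale T using lin T by blast
    obtain v c where v: "v \<in> W" "v \<noteq> 0" "T v = scale c v"
      using eigenvector_exists[OF fd lin[OF T(1)] less.prems(1) less.prems(3)[OF T(1)] less.prems(2)]
      by blast
    let ?E = "{w \<in> W. T w = scale c w}"
    have E: "subspace ?E"
      using less.prems(1)
      by (auto simp: subspace_def T.zero T.add T.scale scale_right_distrib scale_left_commute)
    have "?E \<subset> W" using T(2)[of c] by blast
    then have "dim ?E < dim W"
      using E less.prems(1) by (intro dim_psubset) (simp add: span_eq_iff[THEN iffD2])
    moreover have "?E \<noteq> {0}" using v by blast
    moreover have "S ` ?E \<subseteq> ?E" if "S \<in> F" for S
    proof -
      interpret S: Vector_Spaces.linear scale scale S using lin that by blast
      show ?thesis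
      proof clarify
        fix w assume w: "w \<in> W" "T w = scale c w"
        have "T (S w) = scale c (S w)"
          unfolding less.prems(4)[OF T(1) that w(1)] w(2) by (rule S.scale)
        then show "S w \<in> W \<and> T (S w) = scale c (S w)" using less.prems(3)[OF that] w(1) by blast
      qed
    qed
    ultimately have "\<exists>w\<in>?E. w \<noteq> 0 \<and> (\<forall>T\<in>F. \<exists>c. T w = scale c w)"
      using E less.prems(4) by (intro less.hyps) auto
    then show ?thesis by blast
  qed
qed

section \<open>Non-degenerate forms on finite-dimensional spaces\<close>

lemma finite_span_imp_finite_dimensional:
  assumes "vector_space scale" "finite A" "module.span scale A = UNIV"
  shows "\<exists>Basis. finite_dimensional_vector_space scale Basis"
proof -
  interpret vector_space scale by fact
  obtain C where C: "C \<subseteq> A" "independent C" "A \<subseteq> span C"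
    using maximal_independent_subset by blast
  have "span C = UNIV" using C(3) assms(3) span_minimal[OF C(3) subspace_span] by auto
  with C assms(2) have "finite_dimensional_vector_space scale C"
    by unfold_locales (auto intro: finite_subset)
  then show ?thesis ..
qed

lemma bilinear_form_imp_linear:
  assumes "vector_space s1" "vector_space s2" "bilinear_on s1 UNIV s2 UNIV (*) f"
  shows "Vector_Spaces.linear s1 (*) (\<lambda>x. f x y)" "Vector_Spaces.linear s2 (*) (f x)"
  using assms vector_space_field by (auto simp: Vector_Spaces.linear_iff bilinear_on_def)

text \<open>Non-degeneracy makes the passage from \<open>a\<close> to \<open>B a\<close> injective,
  and in finite dimension injectivity yields surjectivity.\<close>

lemma nondegenerate_form_represents:
  fixes scale :: "'f::field \<Rightarrow> 'a::ab_group_add \<Rightarrow> 'a"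
  assumes fd: "finite_dimensional_vector_space scale Basis"
    and B: "bilinear_on scale UNIV scale UNIV (*) B" "nondegenerate_form_on UNIV B"
    and \<phi>: "Vector_Spaces.linear scale (*) \<phi>"
  shows "\<exists>a. \<forall>x. B a x = \<phi> x"
proof -
  interpret finite_dimensional_vector_space scale Basis by fact
  interpret vector_space_pair scale "(*) :: 'f \<Rightarrow> 'f \<Rightarrow> 'f"
    using vector_space_axioms vector_space_field by (simp add: vector_space_pair_def)
  have b: "B (x + x') y = B x y + B x' y" "B (scale c x) y = c * B x y"
    "B x (y + y') = B x y + B x y'" "B x (scale c y) = c * B x y" for x x' y y' c
    using B(1) unfolding bilinear_on_def by auto
  have lin: "Vector_Spaces.linear scale (*) (B a)" for a
    using vector_space_pair_axioms by (simp add: Vector_Spaces.linear_iff vector_space_pair_def b)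
  \<comment> \<open>\<open>f\<close> stores the values of the functional \<open>B a\<close> on the
    basis as a vector of the original space. It is therefore an endomorphism, and the dual space is
    avoided.\<close>
  define f where "f a = (\<Sum>b\<in>Basis. scale (B a b) b)" for a
  have f: "Vector_Spaces.linear scale scale f"
    using vector_space_axioms
    by (simp add: Vector_Spaces.linear_iff f_def b scale_left_distrib sum.distrib scale_sum_right)
  interpret f: Vector_Spaces.linear scale scale f by (rule f)
  have coord: "u = u'" if "(\<Sum>b\<in>Basis. scale (u b) b) = (\<Sum>b\<in>Basis. scale (u' b) b)"
      "\<And>b. b \<notin> Basis \<Longrightarrow> u b = u' b" for u u' :: "'a \<Rightarrow> 'f"
  proof
    fix b
    have "(\<Sum>b\<in>Basis. scale (u b - u' b) b) = 0"
      using that(1) by (simp add: scale_left_diff_distrib sum_subtractf)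
    then show "u b = u' b"
      using independentD[OF independent_Basis finite_Basis subset_refl, of "\<lambda>b. u b - u' b"] that(2)
      by (cases "b \<in> Basis") auto
  qed
  \<comment> \<open>Since \<open>coord\<close> compares coefficient functions everywhere, both are
    set to 0 outside \<open>Basis\<close>.\<close>
  have val: "B a b = u b" if "f a = (\<Sum>b\<in>Basis. scale (u b) b)" "b \<in> Basis" for a b u
    using fun_cong[OF coord[of "\<lambda>b. if b \<in> Basis then B a b else 0" "\<lambda>b. if b \<in> Basis then u b else 0"], of b]
      that by (simp add: f_def)
  have agree: "B a x = \<psi> x" if "\<And>b. b \<in> Basis \<Longrightarrow> B a b = \<psi> b" "Vector_Spaces.linear scale (*) \<psi>" for a x \<psi>
    using linear_eq_on[OF lin that(2), of x Basis] that(1) by (simp add: span_Basis)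
  have "a = 0" if "f a = 0" for a
  proof -
    have "B a b = 0" if "b \<in> Basis" for b using val[of a "\<lambda>_. 0"] \<open>f a = 0\<close> that by simp
    moreover have "B 0 b = 0" for b using b(2)[of 0 0 b] by simp
    ultimately have "B a x = B 0 x" for x using agree[OF _ lin, of a 0] by simp
    moreover have "B 0 x = 0" for x using b(2)[of 0 0 x] by simp
    ultimately show "a = 0" using B(2) unfolding nondegenerate_form_on_def by simp
  qed
  then have "inj f" using f.inj_iff_eq_0 by blast
  then have "surj f" using linear_inj_imp_surj[OF f] by blast
  then obtain a where "f a = (\<Sum>b\<in>Basis. scale (\<phi> b) b)" by (metis surjD)
  then have "B a x = \<phi> x" for x using agree[OF _ \<phi>] val by blast
  then show ?thesis by blast
qed


section \<open>Product forms on tensor products\<close>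

text \<open>These rules are not applied pointwise: they turn a sum of tensors into a \<open>\<lambda>\<close>-abstraction.\<close>

declare plus_fun_apply [simp del] zero_fun_apply [simp del]

text \<open>The tensor product of the forms \<open>B\<close> and \<gamma>: \<open>Q\<close>
  evaluates in the variables \<open>y\<close>, \<open>t\<close>, then \<open>P\<close> evaluates the
  resulting function of \<open>x\<close>, \<open>s\<close>. Linearity in \<open>P\<close> is
  immediate from this; linearity in \<open>Q\<close> has to be proved.\<close>

definition product_form ::
  "('g \<Rightarrow> 'g \<Rightarrow> 'f::field) \<Rightarrow> ('s \<Rightarrow> 's \<Rightarrow> 'f) \<Rightarrow> ('g, 's, 'f) tensor \<Rightarrow> ('g, 's, 'f) tensor \<Rightarrow> 'f" where
  "product_form B \<gamma> P Q = P (\<lambda>x s. Q (\<lambda>y t. B x y * \<gamma> s t))"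

lemma product_form_left:
  "product_form B \<gamma> (P + P') Q = product_form B \<gamma> P Q + product_form B \<gamma> P' Q"
  "product_form B \<gamma> (tensor_scale c P) Q = c * product_form B \<gamma> P Q"
  "product_form B \<gamma> 0 Q = 0"
  by (simp_all add: product_form_def tensor_scale_def plus_fun_apply zero_fun_apply)

context
  fixes sg :: "'f::field \<Rightarrow> 'g::ab_group_add \<Rightarrow> 'g"
    and sS :: "'f \<Rightarrow> 's::ab_group_add \<Rightarrow> 's"
begin

private abbreviation (input) "tens \<equiv> pure_tensor sg sS"
private abbreviation (input) "TP \<equiv> tensor_product sg sS"
private abbreviation (input) "bil \<equiv> bilinear_on sg UNIV sS UNIV (*)"

lemma bilinear_form_combination:
  assumes "bil \<beta>" "bil \<beta>'"
  shows "bil (\<lambda>x s. c * \<beta> x s + \<beta>' x s)"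
  using assms unfolding bilinear_on_def by (simp add: algebra_simps)

lemma bilinear_form_zero: "bil (\<lambda>x s. 0)"
  by (simp add: bilinear_on_def)

lemma pure_tensor_apply: "bil \<beta> \<Longrightarrow> tens x s \<beta> = \<beta> x s"
  by (simp add: pure_tensor_def)

text \<open>Tensors are equal when they agree at all functions. This settles the functions that are
  not bilinear, so that vanishing need only be tested on bilinear forms.\<close>

lemma tensor_apply_not_bilinear:
  assumes "P \<in> TP" "\<not> bil \<beta>"
  shows "P \<beta> = 0"
  using assms by (induction rule: tensor_product_induct) (simp_all add: tensor_scale_def pure_tensor_def plus_fun_apply zero_fun_apply)

text \<open>Elements of the tensor product are functionals without built-in linearity; on bilinear
  forms they are linear because evaluation at a pair is.\<close>

lemma tensor_apply_combination:
  assumes "P \<in> TP" "bil \<beta>" "bil \<beta>'"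
  shows "P (\<lambda>x s. c * \<beta> x s + \<beta>' x s) = c * P \<beta> + P \<beta>'"
  using assms(1)
proof (induction rule: tensor_product_induct)
  case (add d x s Q)
  have "(tensor_scale d (tens x s) + Q) \<beta>'' = d * \<beta>'' x s + Q \<beta>''" if "bil \<beta>''" for \<beta>''
    using that by (simp add: plus_fun_apply tensor_scale_def pure_tensor_apply)
  then show ?case
    using add assms(2,3) bilinear_form_combination by (simp add: distrib_left mult.left_commute)
qed (simp add: zero_fun_apply)

lemma tensor_apply_zero: "P \<in> TP \<Longrightarrow> P (\<lambda>x s. 0) = 0"
  \<comment> \<open>The coefficient -1 makes the right-hand side cancel.\<close>
  using tensor_apply_combination[OF _ bilinear_form_zero bilinear_form_zero, of P "-1"] by simp

lemma tensor_apply_sum: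
  assumes "P \<in> TP" and \<beta>: "\<And>i. i \<in> A \<Longrightarrow> bil (\<beta> i)"
  shows "bil (\<lambda>x s. \<Sum>i\<in>A. \<beta> i x s) \<and> P (\<lambda>x s. \<Sum>i\<in>A. \<beta> i x s) = (\<Sum>i\<in>A. P (\<beta> i))"
  using \<beta>
proof (induction A rule: infinite_finite_induct)
  case (insert i A)
  then show ?case
    using bilinear_form_combination[of "\<beta> i" "\<lambda>x s. \<Sum>i\<in>A. \<beta> i x s" 1]
      tensor_apply_combination[OF assms(1), of "\<beta> i" "\<lambda>x s. \<Sum>i\<in>A. \<beta> i x s" 1] by simp
qed (use assms(1) in \<open>simp_all add: bilinear_form_zero tensor_apply_zero\<close>)

context
  fixes B :: "'g \<Rightarrow> 'g \<Rightarrow> 'f" and \<gamma> :: "'s \<Rightarrow> 's \<Rightarrow> 'f"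
  assumes B: "bilinear_on sg UNIV sg UNIV (*) B" and \<gamma>: "bilinear_on sS UNIV sS UNIV (*) \<gamma>"
begin

private abbreviation (input) "pf \<equiv> product_form B \<gamma>"

lemma product_bilinear:
  "bil (\<lambda>x s. B x y * \<gamma> s t)" "bil (\<lambda>y t. B x y * \<gamma> s t)"
  using B \<gamma> unfolding bilinear_on_def by (auto simp: algebra_simps)

text \<open>Pure tensors return the default 0 on functions that are not bilinear; this fact ensures
  that the outer evaluation in \<open>product_form\<close> is the intended one.\<close>

lemma product_inner_bilinear:
  assumes "Q \<in> TP"
  shows "bil (\<lambda>x s. Q (\<lambda>y t. B x y * \<gamma> s t))"
  using assms
proof (induction rule: tensor_product_induct)
  case (add c y t Q)
  show ?case
    using bilinear_form_combination[OF product_bilinear(1) add(2)] product_bilinear(2)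
    by (simp add: tensor_scale_def pure_tensor_apply plus_fun_apply)
qed (simp add: bilinear_form_zero zero_fun_apply)

lemma product_form_pure: "pf (tens x s) (tens y t) = B x y * \<gamma> s t"
  by (simp add: product_form_def pure_tensor_apply product_bilinear)

lemma product_form_symmetric:
  assumes "symmetric_form_on UNIV B" "symmetric_form_on UNIV \<gamma>" "P \<in> TP" "Q \<in> TP"
  shows "pf P Q = pf Q P"
proof -
  have sym: "B x y * \<gamma> s t = B y x * \<gamma> t s" for x y s t
    using assms(1,2) unfolding symmetric_form_on_def by simp
  show ?thesis using assms(3)
  proof (induction rule: tensor_product_induct)
    case zero
    then show ?case using assms(4) by (simp add: product_form_def tensor_apply_zero zero_fun_apply)
  next
    case (add c x s R)
    have "pf Q (tensor_scale c (tens x s) + R) =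
      Q (\<lambda>y t. c * (B x y * \<gamma> s t) + R (\<lambda>x s. B y x * \<gamma> t s))"
      by (simp add: product_form_def tensor_scale_def plus_fun_apply pure_tensor_apply product_bilinear(2) sym)
    also have "\<dots> = c * Q (\<lambda>y t. B x y * \<gamma> s t) + pf Q R"
      unfolding product_form_def
      by (intro tensor_apply_combination assms(4) product_bilinear product_inner_bilinear add)
    also have "Q (\<lambda>y t. B x y * \<gamma> s t) = pf (tens x s) Q"
      by (simp add: product_form_def pure_tensor_apply product_inner_bilinear assms(4))
    finally show ?case using add by (simp add: product_form_left)
  qed
qed

text \<open>Symmetry carries linearity over from the first argument.\<close>

lemma product_form_right:
  assumes "symmetric_form_on UNIV B" "symmetric_form_on UNIV \<gamma>" "P \<in> TP" "Q \<in> TP" "Q' \<in> TP"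
  shows "pf P (Q + Q') = pf P Q + pf P Q'" "pf P (tensor_scale c Q) = c * pf P Q"
proof -
  interpret T: vector_space "tensor_scale :: 'f \<Rightarrow> ('g, 's, 'f) tensor \<Rightarrow> _"
    by (rule vector_space_tensor_scale)
  have "Q + Q' \<in> TP" "tensor_scale c Q \<in> TP"
    using assms tensor_product_subspace T.subspace_add T.subspace_scale by blast+
  then show "pf P (Q + Q') = pf P Q + pf P Q'" "pf P (tensor_scale c Q) = c * pf P Q"
    using assms by (simp_all add: product_form_symmetric[of P] product_form_left)
qed

text \<open>Every bilinear form \<beta> is a finite sum of products
  \<open>B x (y b) * \<gamma> s (dual b)\<close>: expand \<open>s\<close> in the basis
  \<open>BS\<close>, then represent the coordinates by \<gamma> and the functionals \<beta>(-, b) by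
  \<open>B\<close>. So \<open>P \<beta>\<close> is a sum of pairings of \<open>P\<close> with pure
  tensors, all of which vanish.\<close>

lemma product_form_nondegenerate:
  assumes fd: "finite_dimensional_vector_space sg Bg" "finite_dimensional_vector_space sS BS"
    and nondeg: "nondegenerate_form_on UNIV B" "nondegenerate_form_on UNIV \<gamma>"
    and sym: "symmetric_form_on UNIV B" "symmetric_form_on UNIV \<gamma>"
  shows "nondegenerate_form_on TP pf"
  unfolding nondegenerate_form_on_def
proof (intro ballI impI ext)
  fix P \<beta> assume P: "P \<in> TP" "\<forall>Q\<in>TP. pf P Q = 0"
  interpret G: finite_dimensional_vector_space sg Bg by fact
  interpret S: finite_dimensional_vector_space sS BS by fact
  interpret SF: vector_space_pair sS "(*) :: 'f \<Rightarrow> 'f \<Rightarrow> 'f"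
    using S.vector_space_axioms vector_space_field by (simp add: vector_space_pair_def)
  show "P \<beta> = 0 \<beta>"
  proof (cases "bil \<beta>")
    case True
    note lin = bilinear_form_imp_linear[OF G.vector_space_axioms S.vector_space_axioms True]
    \<comment> \<open>The vectors representing the coordinates form the basis dual to
      \<open>BS\<close> with respect to \<gamma>.\<close>
    have "\<exists>b'. \<forall>s. \<gamma> b' s = S.representation BS s b" for b
      using S.vector_space_axioms vector_space_field S.independent_Basis S.span_Basis
      by (intro nondegenerate_form_represents[OF fd(2) \<gamma> nondeg(2)])
         (simp add: Vector_Spaces.linear_iff S.representation_add S.representation_scale)
    then obtain dual where "\<And>b s. \<gamma> (dual b) s = S.representation BS s b" by metis
    then have dual: "\<gamma> s (dual b) = S.representation BS s b" for b s
      using sym(2) unfolding symmetric_form_on_def by simp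
    have "\<exists>y. \<forall>x. B y x = \<beta> x b" for b
      by (rule nondegenerate_form_represents[OF fd(1) B nondeg(1) lin(1)])
    then obtain y where "\<And>b x. B (y b) x = \<beta> x b" by metis
    then have y: "B x (y b) = \<beta> x b" for b x
      using sym(1) unfolding symmetric_form_on_def by simp
    have "\<beta> x s = (\<Sum>b\<in>BS. B x (y b) * \<gamma> s (dual b))" for x s
    proof -
      have "\<beta> x s = \<beta> x (\<Sum>b\<in>BS. sS (S.representation BS s b) b)"
        using S.sum_representation_eq[OF S.independent_Basis _ S.finite_Basis subset_refl, of s]
        by (simp add: S.span_Basis)
      also have "\<dots> = (\<Sum>b\<in>BS. S.representation BS s b * \<beta> x b)"
        by (simp add: SF.linear_sum[OF lin(2)] SF.linear_scale[OF lin(2)])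
      finally show ?thesis by (simp add: dual y mult.commute)
    qed
    then have "\<beta> = (\<lambda>x s. \<Sum>b\<in>BS. B x (y b) * \<gamma> s (dual b))" by blast
    then have "P \<beta> = (\<Sum>b\<in>BS. P (\<lambda>x s. B x (y b) * \<gamma> s (dual b)))"
      using tensor_apply_sum[OF P(1), of BS "\<lambda>b x s. B x (y b) * \<gamma> s (dual b)"] product_bilinear(1)
      by simp
    also have "\<dots> = (\<Sum>b\<in>BS. pf P (tens (y b) (dual b)))"
      by (simp add: product_form_def pure_tensor_apply product_bilinear)
    also have "\<dots> = 0" using P(2) pure_tensor_in by (intro sum.neutral) blast
    finally show ?thesis by (simp add: zero_fun_apply)
  qed (use P(1) tensor_apply_not_bilinear in \<open>auto simp: zero_fun_apply\<close>)
qed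

end

end

text \<open>On pure tensors, invariance is the product of the invariance of \<open>B\<close> and
  that of \<gamma>. It is extended to all tensors one argument at a time, starting with the
  last.\<close>

lemma product_form_invariant_metric:
  fixes sg :: "'f::field \<Rightarrow> 'g::ab_group_add \<Rightarrow> 'g"
    and sS :: "'f \<Rightarrow> 's::{comm_ring, monoid_mult} \<Rightarrow> 's"
  assumes q: "quadratic_lie_algebra sg UNIV bracket B" and S: "comm_unital_algebra sS"
    and \<gamma>: "bilinear_on sS UNIV sS UNIV (*) \<gamma>" "nondegenerate_form_on UNIV \<gamma>"
      "symmetric_form_on UNIV \<gamma>" "invariant_form \<gamma>"
  shows "invariant_metric tensor_scale (tensor_product sg sS) (current_bracket sg sS bracket)
    (product_form B \<gamma>)"
proof -
  interpret G: quadratic_lie_algebra sg UNIV bracket B by (rule q)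
  interpret S: comm_unital_algebra sS by (rule S)
  note G = G.lie_algebra_axioms
  have B: "bilinear_on sg UNIV sg UNIV (*) B" "symmetric_form_on UNIV B"
    "nondegenerate_form_on UNIV B" "B x (bracket y z) = B (bracket x y) z" for x y z
    using G.metric unfolding invariant_metric_def by auto
  note left = product_form_left[of B \<gamma>]
  note right = product_form_right[OF B(1) \<gamma>(1) B(2) \<gamma>(3)]
  note TP = TP_closed[OF G S] pure_tensor_in[of sg sS] current_bracket_closed[OF G S]
  note br_left = current_bracket_add_left current_bracket_scale_left current_bracket_zero_left
  note br_right = current_bracket_right[OF G S]
  let ?TP = "tensor_product sg sS" and ?br = "current_bracket sg sS bracket"
    and ?pf = "product_form B \<gamma>" and ?tens = "pure_tensor sg sS"
  have zero_right: "?pf P 0 = 0" if "P \<in> ?TP" for P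
    using right(2)[OF that TP(3) TP(3), of 0] by (simp add: tensor_scale_def zero_fun_def)
  have pure: "?pf (?tens x s) (?br (?tens y t) (?tens z u)) = ?pf (?br (?tens x s) (?tens y t)) (?tens z u)"
    for x s y t z u
    using \<gamma>(4) B(4)
    by (simp add: current_bracket_pure[OF G S] product_form_pure[OF B(1) \<gamma>(1)] invariant_form_def)
  have inv2: "?pf (?tens x s) (?br (?tens y t) R) = ?pf (?br (?tens x s) (?tens y t)) R"
    if "R \<in> ?TP" for x s y t R
    using that
  proof (induction rule: tensor_product_induct)
    case zero
    then show ?case by (simp add: zero_right TP br_right(3)[of _ 0 0])
  next
    case (add c z u R)
    then show ?case
      by (simp add: right(1) right(2)[of _ _ 0] TP br_right(1) br_right(2)[of _ _ 0] pure)
  qed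
  have inv1: "?pf (?tens x s) (?br Q R) = ?pf (?br (?tens x s) Q) R"
    if "Q \<in> ?TP" "R \<in> ?TP" for x s Q R
    using that(1)
  proof (induction rule: tensor_product_induct)
    case zero
    then show ?case by (simp add: zero_right TP br_right(3)[of _ 0 0] br_left[OF G S] left)
  next
    case (add c y t Q)
    with that(2) show ?case
      by (simp add: right(1) right(2)[of _ _ 0] TP br_right(1) br_right(2)[of _ _ 0] br_left[OF G S]
          left inv2)
  qed
  have inv: "?pf P (?br Q R) = ?pf (?br P Q) R" if "P \<in> ?TP" "Q \<in> ?TP" "R \<in> ?TP" for P Q R
    using that(1)
  proof (induction rule: tensor_product_induct)
    case zero
    then show ?case by (simp add: br_left[OF G S] left)
  next
    case (add c x s P)
    with that(2,3) show ?case by (simp add: br_left[OF G S] left inv1)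
  qed
  obtain Bg BS where "finite_dimensional_vector_space sg Bg" "finite_dimensional_vector_space sS BS"
    using finite_span_imp_finite_dimensional[OF G.vector_space_axioms] G.finite_dim
      finite_span_imp_finite_dimensional[OF S.vector_space_axioms] S.finite_dim by metis
  then show ?thesis
    unfolding invariant_metric_def bilinear_on_def
    using product_form_nondegenerate[OF B(1) \<gamma>(1) _ _ B(3) \<gamma>(2) B(2) \<gamma>(3)]
      product_form_symmetric[OF B(1) \<gamma>(1) B(2) \<gamma>(3)] inv left right
    by (auto simp: symmetric_form_on_def)
qed

section \<open>From a metric on the current algebra to a form on the coefficients\<close>

text \<open>If both vectors are nonzero, functionals separate them from 0, and the product of these
  functionals is a bilinear form on which the pure tensor does not vanish.\<close>

lemma pure_tensor_eq_zero_imp: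
  assumes "vector_space sg" "vector_space sS" "pure_tensor sg sS x s = 0"
  shows "x = 0 \<or> s = 0"
proof (rule ccontr)
  assume "\<not> (x = 0 \<or> s = 0)"
  then obtain \<phi> \<psi> where \<phi>: "Vector_Spaces.linear sg (*) \<phi>" "\<phi> x \<noteq> \<phi> 0"
    and \<psi>: "Vector_Spaces.linear sS (*) \<psi>" "\<psi> s \<noteq> \<psi> 0"
    using functionals_separate[OF assms(1), of x 0] functionals_separate[OF assms(2), of s 0] by blast
  have "bilinear_on sg UNIV sS UNIV (*) (\<lambda>x s. \<phi> x * \<psi> s)"
    using \<phi>(1) \<psi>(1) by (auto simp: bilinear_on_def Vector_Spaces.linear_iff algebra_simps)
  from pure_tensor_apply[OF this, of x s] have "\<phi> x * \<psi> s = 0"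
    by (simp add: assms(3) zero_fun_apply)
  interpret p: Vector_Spaces.linear sg "(*)" \<phi> by fact
  interpret q: Vector_Spaces.linear sS "(*)" \<psi> by fact
  show False using \<open>\<phi> x * \<psi> s = 0\<close> \<phi>(2) \<psi>(2) by (simp add: p.zero q.zero)
qed

lemma invariant_form_of_current_metric:
  fixes sg :: "'f::alg_closed_field \<Rightarrow> 'g::ab_group_add \<Rightarrow> 'g"
    and sS :: "'f \<Rightarrow> 's::{comm_ring, monoid_mult} \<Rightarrow> 's"
  assumes q: "quadratic_lie_algebra sg UNIV bracket B" and nonab: "\<not> abelian_on UNIV bracket"
    and S: "comm_unital_algebra sS"
    and Bt: "invariant_metric tensor_scale (tensor_product sg sS) (current_bracket sg sS bracket) Bt"
  shows "\<exists>\<gamma>. bilinear_on sS UNIV sS UNIV (*) \<gamma> \<and> nondegenerate_form_on UNIV \<gamma> \<and>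
    symmetric_form_on UNIV \<gamma> \<and> invariant_form \<gamma>"
proof -
  interpret G: quadratic_lie_algebra sg UNIV bracket B by (rule q)
  interpret S: comm_unital_algebra sS by (rule S)
  interpret GG: vector_space_pair sg sg
    using G.vector_space_axioms by (simp add: vector_space_pair_def)
  note G = G.lie_algebra_axioms
  let ?TP = "tensor_product sg sS" and ?tens = "pure_tensor sg sS"
    and ?br = "current_bracket sg sS bracket"
  obtain Bg where fd: "finite_dimensional_vector_space sg Bg"
    using finite_span_imp_finite_dimensional[OF G.vector_space_axioms] G.finite_dim by metis
  have B: "bilinear_on sg UNIV sg UNIV (*) B" "nondegenerate_form_on UNIV B"
    and B_inv: "B x (bracket y z) = B (bracket x y) z" for x y z
    using G.metric unfolding invariant_metric_def by auto
  have B_lin: "B (x + x') y = B x y + B x' y" "B (sg c x) y = c * B x y" for c x x' y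
    using B(1) unfolding bilinear_on_def by auto
  have B_diff: "B (x - x') y = B x y - B x' y" for x x' y
    using B_lin(1)[of "x - x'" x' y] by simp
  have B_eqI: "a = a'" if "\<And>y. B a y = B a' y" for a a'
    using B(2) that unfolding nondegenerate_form_on_def
    by (metis B_diff UNIV_I eq_iff_diff_eq_0)
  have Bt_lin: "Bt (P + P') Q = Bt P Q + Bt P' Q" "Bt (tensor_scale c P) Q = c * Bt P Q"
    "Bt Q (P + P') = Bt Q P + Bt Q P'" "Bt Q (tensor_scale c P) = c * Bt Q P"
    if "P \<in> ?TP" "P' \<in> ?TP" "Q \<in> ?TP" for c P P' Q
    using Bt that unfolding invariant_metric_def bilinear_on_def by auto
  have Bt_nondeg: "P = 0" if "P \<in> ?TP" "\<And>Q. Q \<in> ?TP \<Longrightarrow> Bt P Q = 0" for P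
    using Bt that unfolding invariant_metric_def nondegenerate_form_on_def by auto
  have Bt_inv: "Bt P (?br Q R) = Bt (?br P Q) R" if "P \<in> ?TP" "Q \<in> ?TP" "R \<in> ?TP" for P Q R
    using Bt that unfolding invariant_metric_def by auto
  note tens = pure_simps[OF G S] pure_tensor_in[of sg sS]
  note Bt_pure = Bt_lin(1,3) Bt_lin(2)[of _ "?tens 0 0"] Bt_lin(4)[of _ "?tens 0 0"]

  have "\<exists>a. \<forall>y. B a y = Bt (?tens x s) (?tens y t)" for s t x
    using G.vector_space_axioms vector_space_field
    by (intro nondegenerate_form_represents[OF fd B])
       (simp add: Vector_Spaces.linear_iff tens Bt_pure)
  then have "\<exists>D. \<forall>s t x y. B (D s t x) y = Bt (?tens x s) (?tens y t)"
    by (intro choice allI)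
  then obtain D where D: "\<And>s t x y. B (D s t x) y = Bt (?tens x s) (?tens y t)" by blast
  have D_lin: "Vector_Spaces.linear sg sg (D s t)" for s t
    using G.vector_space_axioms
    by (auto simp: Vector_Spaces.linear_iff D B_lin tens Bt_pure intro!: B_eqI)
  have D_right: "D s (t + t') x = D s t x + D s t' x" "D s (sS c t) x = sg c (D s t x)" for s t t' c x
    by (auto simp: D B_lin tens Bt_pure intro!: B_eqI)
  \<comment> \<open>Pair both sides with \<open>z\<close>: invariance of \<open>B\<close> and then
    of \<open>Bt\<close> moves the bracket from one argument to the other.\<close>
  have D_inv: "D (s * t) u (bracket x y) = bracket (D s (t * u) x) y" for s t u x y
  proof (rule B_eqI)
    fix z
    have "B (bracket (D s (t * u) x) y) z = Bt (?tens x s) (?br (?tens y t) (?tens z u))"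
      by (simp add: B_inv[symmetric] D current_bracket_pure[OF G S])
    also have "\<dots> = Bt (?br (?tens x s) (?tens y t)) (?tens z u)"
      by (intro Bt_inv tens)
    finally show "B (D (s * t) u (bracket x y)) z = B (bracket (D s (t * u) x) y) z"
      by (simp add: D current_bracket_pure[OF G S])
  qed
  \<comment> \<open>Middle coefficient 1 puts every \<open>D s t\<close> in the centroid of g;
    antisymmetry then gives the rule for the second factor.\<close>
  have D_left: "D s t (bracket x y) = bracket (D s t x) y" for s t x y
    using D_inv[of s 1 t] by simp
  have D_snd: "D s t (bracket x y) = bracket x (D s t y)" for s t x y
  proof -
    interpret L: Vector_Spaces.linear sg sg "D s t" by (rule D_lin)
    show ?thesis using D_left[of s t y x] by (simp add: br_neg[OF G S, of x "D s t y"] br_neg[OF G S, of x y] L.neg)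
  qed
  \<comment> \<open>With first coefficient 1 this says that, on brackets, \<open>D t u\<close>
    depends only on the product \<open>t * u\<close>.\<close>
  have D_shift: "D (s * t) u (bracket x y) = D s (t * u) (bracket x y)" for s t u x y
    by (rule trans[OF D_inv D_left[symmetric]])

  \<comment> \<open>\<open>W\<close> is the derived algebra, nonzero because g is not Abelian.
    Identities checked on brackets extend to it by linearity.\<close>
  define W where "W = G.span {bracket x y |x y. True}"
  have base: "bracket x y \<in> W" for x y unfolding W_def by (rule G.span_base) blast
  have on_W: "f w = g w" if "Vector_Spaces.linear sg sg f" "Vector_Spaces.linear sg sg g"
      "\<And>x y. f (bracket x y) = g (bracket x y)" "w \<in> W" for f g w
    using GG.linear_eq_on[OF that(1,2) that(4)[unfolded W_def]] that(3) by blast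
  have "\<exists>w\<in>W. w \<noteq> 0 \<and> (\<forall>T\<in>range (D 1). \<exists>c. T w = sg c w)"
  proof (rule common_eigenvector_exists[OF fd])
    show "G.subspace W" unfolding W_def by (rule G.subspace_span)
    show "W \<noteq> {0}" using nonab base unfolding abelian_on_def by blast
    show "Vector_Spaces.linear sg sg T" if "T \<in> range (D 1)" for T using that D_lin by blast
    show "T ` W \<subseteq> W" if "T \<in> range (D 1)" for T
    proof -
      interpret L: Vector_Spaces.linear sg sg T using that D_lin by blast
      have "T ` {bracket x y |x y. True} \<subseteq> W" using that base by (auto simp: D_left)
      then show ?thesis
        unfolding W_def L.span_image[symmetric] by (rule G.span_minimal) (rule G.subspace_span)
    qed
    show "T (T' w) = T' (T w)" if T: "T \<in> range (D 1)" "T' \<in> range (D 1)" "w \<in> W" for T T' w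
    proof -
      have lin: "Vector_Spaces.linear sg sg T" "Vector_Spaces.linear sg sg T'"
        using T D_lin by blast+
      have "(T \<circ> T') w = (T' \<circ> T) w"
      proof (rule on_W[OF Vector_Spaces.linear_compose[OF lin(2,1)] Vector_Spaces.linear_compose[OF lin] _ T(3)])
        fix x y
        \<comment> \<open>One operator is moved to the second factor and the other to the first,
          where their order no longer matters.\<close>
        have "T (T' (bracket x y)) = T (bracket x (T' y))" using T(2) by (auto simp: D_snd)
        also have "\<dots> = bracket (T x) (T' y)" using T(1) by (auto simp: D_left)
        also have "\<dots> = T' (bracket (T x) y)" using T(2) by (auto simp: D_snd)
        also have "bracket (T x) y = T (bracket x y)" using T(1) by (auto simp: D_left)
        finally show "(T \<circ> T') (bracket x y) = (T' \<circ> T) (bracket x y)" by simp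
      qed
      then show ?thesis by simp
    qed
  qed
  then obtain w where w: "w \<in> W" "w \<noteq> 0" and "\<forall>u. \<exists>c. D 1 u w = sg c w" by blast
  then obtain l where l: "\<And>u. D 1 u w = sg (l u) w" using choice by metis
  \<comment> \<open>As \<open>w\<close> is nonzero, the eigenvalue is determined by
    \<open>u\<close>, so \<open>l\<close> inherits linearity from the second coefficient of
    \<open>D\<close>.\<close>
  have l_eqI: "c = d" if "sg c w = sg d w" for c d using that w(2) by simp
  have l_add: "l (s + t) = l s + l t" for s t
    by (rule l_eqI) (simp only: l[symmetric] D_right G.scale_left_distrib)
  have l_scale: "l (sS c s) = c * l s" for c s
    by (rule l_eqI) (simp only: l[symmetric] D_right G.scale_scale[symmetric])
  have "s = 0" if "\<And>t. l (s * t) = 0" for s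
  proof -
    have pure: "Bt (?tens w s) (?tens y t) = 0" for y t
    proof -
      \<comment> \<open>The right-hand side is \<open>l (s * t)\<close> times \<open>w\<close>,
        which is 0 by the choice of \<open>s\<close>.\<close>
      have "D s t w = D 1 (s * t) w"
        using on_W[OF D_lin D_lin _ w(1), of s t 1 "s * t"] D_shift[of 1 s t] by simp
      then have "B (D s t w) y = 0" using B_lin(2)[of 0 w y] by (simp add: l that)
      then show ?thesis by (simp add: D)
    qed
    have "Bt (?tens w s) Q = 0" if "Q \<in> ?TP" for Q
      using that
    proof (induction rule: tensor_product_induct)
      case zero
      then show ?case
        using Bt_lin(4)[of "?tens 0 0" "?tens 0 0" "?tens w s" 0] tens
        by (simp add: tensor_scale_def zero_fun_def)
    next
      case (add c y t Q)
      then show ?case by (simp add: Bt_pure tens TP_closed[OF G S] pure)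
    qed
    then have "?tens w s = 0" by (intro Bt_nondeg tens)
    then show "s = 0"
      using pure_tensor_eq_zero_imp[OF G.vector_space_axioms S.vector_space_axioms] w(2) by blast
  qed
  \<comment> \<open>Symmetry and invariance of this form are commutativity and associativity of
    S.\<close>
  then show ?thesis
    by (intro exI[of _ "\<lambda>s t. l (s * t)"])
       (auto simp: bilinear_on_def nondegenerate_form_on_def symmetric_form_on_def invariant_form_def
         mult_simps[OF G S] distrib_left distrib_right l_add l_scale mult_ac)
qed

theorem corollary1p3:
  fixes scale_g :: "'f::{alg_closed_field, field_char_0} \<Rightarrow> 'g::ab_group_add \<Rightarrow> 'g"
    and bracket :: "'g \<Rightarrow> 'g \<Rightarrow> 'g"
    and B :: "'g \<Rightarrow> 'g \<Rightarrow> 'f"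
    and scale_S :: "'f \<Rightarrow> 's::{comm_ring, monoid_mult} \<Rightarrow> 's"
  assumes "quadratic_lie_algebra scale_g UNIV bracket B"
    and "\<not> abelian_on UNIV bracket"
    and "indecomposable scale_g UNIV bracket B"
    and "comm_unital_algebra scale_S"
  shows "(\<exists>Bt. invariant_metric tensor_scale (tensor_product scale_g scale_S)
              (current_bracket scale_g scale_S bracket) Bt) \<longleftrightarrow>
         (\<exists>\<gamma>. bilinear_on scale_S UNIV scale_S UNIV (*) \<gamma> \<and>
              nondegenerate_form_on UNIV \<gamma> \<and> symmetric_form_on UNIV \<gamma> \<and> invariant_form \<gamma>)"
  using invariant_form_of_current_metric[OF assms(1,2,4)] product_form_invariant_metric[OF assms(1,4)]
  by blast

end
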